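(* Let $p\le n$, let $X\in\mathbb R^{n\times p}$ have full rank $p$, let $f:\mathbb R^{n\times p}\to\mathbb R$ be continuously differentiable, and let $g$ be the metric $$g(\xi,\zeta)=\langle\widetilde{G_T}(X)\mathrm{Proj}_X[\xi],\zeta\rangle+\langle\widetilde{G_N}(X)\mathrm{Proj}_X^\perp[\xi],\zeta\rangle$$ built from the projectors $\mathrm{Proj}_X,\mathrm{Proj}_X^\perp$ and operators $\widetilde{G_T}(X),\widetilde{G_N}(X)$ described in the context. Let $H(X):\mathrm{Sym}(p)\to\mathrm{Sym}(p)$ be symmetric positive definite. Then the landing directions $d_T(X)=-\mathrm{grad}^g_{\mathrm{St}_{X^\top X}}f(X)$ and $d_N(X)=-\mathrm Dc(X)^{\dagger,g}H(X)[c(X)]$ are given by $$d_T(X)=-\widetilde{G_T}(X)^{-1}\big[X\operatorname{skew}((X^\top X)^{-1}X^\top\nabla_{\mathcal E}f(X))+(\mathrm I_n-X(X^\top X)^{-1}X^\top)\nabla_{\mathcal E}f(X)\big],$$ $$d_N(X)=-X(X^\top X)^{-1}\operatorname{sym}(X^\top XS),$$ where $S\in\mathrm{Sym}(p)$ is the solution of the Sylvester equation $\frac12(X^\top XS+SX^\top X)=T$ with $T=\frac12H(X)[X^\top X-\mathrm I_p]$. The expression of $d_N(X)$ becomes explicit in the following cases: (i) if $H(X)=\mathrm{Id}_{\mathcal F}$, then $d_N(X)=-\frac12X(\mathrm I_p-(X^\top X)^{-1})$; (ii) if $H(X)=\mathrm Dc(X)\mathrm Dc(X)^{*,g}$, then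 $d_N(X)=-\frac12\widetilde{G_N}(X)^{-1}[X(X^\top X-\mathrm I_p)]$; (iii) if $H(X)=\mathrm Dc(X)\mathrm Dc(X)^{*,\mathcal E}$, then $d_N(X)=-X(X^\top X-\mathrm I_p)$.
   Context: $\mathcal E=\mathbb R^{n\times p}$ and $\mathcal F=\mathrm{Sym}(p)$ (symmetric $p\times p$ matrices) carry the Frobenius inner product $\langle X,Y\rangle=\operatorname{trace}(X^\top Y)$; $\operatorname{sym}(A)=(A+A^\top)/2$, $\operatorname{skew}(A)=(A-A^\top)/2$. $c(X)=\frac12(X^\top X-\mathrm I_p)$. $\nabla_{\mathcal E}f$ is the Frobenius gradient; $^{*,\mathcal E}$ the adjoint and $^{\perp,\mathcal E}$ the orthogonal complement for the Frobenius inner product. $\mathrm{St}_{X^\top X}=\{Y:Y^\top Y=X^\top X\}$, $\mathrm T_X\mathrm{St}_{X^\top X}=\{\xi:\xi^\top X+X^\top\xi=0\}$. $\mathrm{Proj}_X[Z]=X(X^\top X)^{-1}\operatorname{skew}(X^\top Z)+(\mathrm I_n-X(X^\top X)^{-1}X^\top)Z$, $\mathrm{Proj}_X^\perp[Z]=X(X^\top X)^{-1}\operatorname{sym}(X^\top Z)$; these are complementary linear projectors with ranges $\mathrm T_X\mathrm{St}_{X^\top X}$ and $\mathrm N_X\mathrm{St}_{X^\top X}=\{X(X^\top X)^{-1}S:S\in\mathrm{Sym}(p)\}$. $G_T(X),G_N(X):\mathcal E\to\mathcal E$ are any Frobenius-symmetric operators, positive definite on $\mathrm T_X\mathrm{St}_{X^\top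 X}$ and $\mathrm N_X\mathrm{St}_{X^\top X}$ respectively, and $\widetilde{G_T}(X)=\mathrm{Proj}_X^{*,\mathcal E}G_T(X)\mathrm{Proj}_X:\mathrm T_X\mathrm{St}_{X^\top X}\to(\mathrm N_X\mathrm{St}_{X^\top X})^{\perp,\mathcal E}$, $\widetilde{G_N}(X)=(\mathrm{Proj}_X^\perp)^{*,\mathcal E}G_N(X)\mathrm{Proj}_X^\perp:\mathrm N_X\mathrm{St}_{X^\top X}\to(\mathrm T_X\mathrm{St}_{X^\top X})^{\perp,\mathcal E}$, which are invertible between the indicated spaces; inverses refer to these maps. $\mathrm{grad}^g_{\mathrm{St}_{X^\top X}}f(X)$ is the unique tangent vector with $g(\mathrm{grad}^g_{\mathrm{St}_{X^\top X}}f(X),\xi)=\mathrm Df(X)[\xi]$ for all tangent $\xi$; $\mathrm Dc(X)^{*,g}$ is defined by $\langle\mathrm Dc(X)[\xi],S\rangle=g(\xi,\mathrm Dc(X)^{*,g}[S])$ for all $\xi\in\mathcal E$, $S\in\mathcal F$; $\mathrm Dc(X)^{\dagger,g}=\mathrm Dc(X)^{*,g}(\mathrm Dc(X)\mathrm Dc(X)^{*,g})^{-1}$.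
   Formalization: In case (iii) the formula is corrected to d_N(X) = -(1/2) X(X^T X - I_p); the printed one lacks the factor 1/2 and fails e.g. for n = p = 1, X = 2, where d_N = -3 and not -6. *)

theory Defs
  imports "HOL-Analysis.Analysis"
begin

text \<open>An \<open>n \<times> p\<close> matrix has type \<open>real ^ 'p ^ 'n\<close>, whose inner product \<open>\<bullet>\<close> is the
  Frobenius inner product (lemma \<open>frobenius_inner\<close>).  All adjoints, gradients and orthogonal
  complements taken from the library are therefore the Frobenius ones.\<close>

lemma frobenius_inner:
  fixes X Y :: "real ^ 'p ^ 'n"
  shows "X \<bullet> Y = trace (transpose X ** Y)"
proof -
  have "X \<bullet> Y = (\<Sum>i\<in>UNIV. \<Sum>j\<in>UNIV. X $ i $ j * Y $ i $ j)"
    by (simp add: inner_vec_def)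
  also have "\<dots> = trace (transpose X ** Y)"
    by (subst sum.swap) (simp add: trace_def matrix_matrix_mult_def transpose_def)
  finally show ?thesis .
qed

definition SymM :: "(real ^ 'p ^ 'p) set"
  where "SymM = {S. transpose S = S}"

definition msym :: "real ^ 'p ^ 'p \<Rightarrow> real ^ 'p ^ 'p"
  where "msym A = (1/2) *\<^sub>R (A + transpose A)"

definition mskew :: "real ^ 'p ^ 'p \<Rightarrow> real ^ 'p ^ 'p"
  where "mskew A = (1/2) *\<^sub>R (A - transpose A)"

text \<open>Operators on a subspace are total functions, considered on that subspace only.\<close>

definition symmetric_operator_on :: "'a::real_inner set \<Rightarrow> ('a \<Rightarrow> 'a) \<Rightarrow> bool"
  where "symmetric_operator_on V A \<longleftrightarrow>
    A ` V \<subseteq> V \<and>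
    (\<forall>x\<in>V. \<forall>y\<in>V. A (x + y) = A x + A y) \<and>
    (\<forall>r. \<forall>x\<in>V. A (r *\<^sub>R x) = r *\<^sub>R A x) \<and>
    (\<forall>x\<in>V. \<forall>y\<in>V. A x \<bullet> y = x \<bullet> A y)"

definition pos_def_on :: "'a::real_inner set \<Rightarrow> ('a \<Rightarrow> 'a) \<Rightarrow> bool"
  where "pos_def_on V A \<longleftrightarrow> (\<forall>x\<in>V. x \<noteq> 0 \<longrightarrow> A x \<bullet> x > 0)"

definition continuously_differentiable :: "('a::real_normed_vector \<Rightarrow> real) \<Rightarrow> bool"
  where "continuously_differentiable f \<longleftrightarrow>
    (\<exists>f' :: 'a \<Rightarrow> 'a \<Rightarrow>\<^sub>L real.
      (\<forall>x. (f has_derivative blinfun_apply (f' x)) (at x)) \<and> continuous_on UNIV f')"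

definition gradE :: "(real ^ 'p ^ 'n \<Rightarrow> real) \<Rightarrow> real ^ 'p ^ 'n \<Rightarrow> real ^ 'p ^ 'n"
  where "gradE f X = (THE D. GDERIV f X :> D)"

definition constr :: "real ^ 'p ^ 'n \<Rightarrow> real ^ 'p ^ 'p"
  where "constr X = (1/2) *\<^sub>R (transpose X ** X - mat 1)"

definition Dc :: "real ^ 'p ^ 'n \<Rightarrow> real ^ 'p ^ 'n \<Rightarrow> real ^ 'p ^ 'p"
  where "Dc X = frechet_derivative constr (at X)"

definition gram_inv :: "real ^ 'p ^ 'n \<Rightarrow> real ^ 'p ^ 'p"
  where "gram_inv X = matrix_inv (transpose X ** X)"

definition tangentSt :: "real ^ 'p ^ 'n \<Rightarrow> (real ^ 'p ^ 'n) set"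
  where "tangentSt X = {\<xi>. transpose \<xi> ** X + transpose X ** \<xi> = 0}"

definition normalSt :: "real ^ 'p ^ 'n \<Rightarrow> (real ^ 'p ^ 'n) set"
  where "normalSt X = {X ** gram_inv X ** S |S. S \<in> SymM}"

definition ProjT :: "real ^ 'p ^ 'n \<Rightarrow> real ^ 'p ^ 'n \<Rightarrow> real ^ 'p ^ 'n"
  where "ProjT X Z = X ** gram_inv X ** mskew (transpose X ** Z)
    + (mat 1 - X ** gram_inv X ** transpose X) ** Z"

definition ProjN :: "real ^ 'p ^ 'n \<Rightarrow> real ^ 'p ^ 'n \<Rightarrow> real ^ 'p ^ 'n"
  where "ProjN X Z = X ** gram_inv X ** msym (transpose X ** Z)"

text \<open>\<open>tildeT\<close> and \<open>tildeN\<close> are the defining compositions on the whole matrix space.  Their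
  inverses \<open>tildeT_inv\<close>, \<open>tildeN_inv\<close> are those of the restrictions
  \<open>tangentSt X \<rightarrow> (normalSt X)\<^sup>\<bottom>\<close> and \<open>normalSt X \<rightarrow> (tangentSt X)\<^sup>\<bottom>\<close>, hence \<open>inv_into\<close>.\<close>

definition tildeT ::
    "(real ^ 'p ^ 'n \<Rightarrow> real ^ 'p ^ 'n \<Rightarrow> real ^ 'p ^ 'n) \<Rightarrow>
     real ^ 'p ^ 'n \<Rightarrow> real ^ 'p ^ 'n \<Rightarrow> real ^ 'p ^ 'n"
  where "tildeT G_T X = adjoint (ProjT X) \<circ> G_T X \<circ> ProjT X"

definition tildeN ::
    "(real ^ 'p ^ 'n \<Rightarrow> real ^ 'p ^ 'n \<Rightarrow> real ^ 'p ^ 'n) \<Rightarrow>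
     real ^ 'p ^ 'n \<Rightarrow> real ^ 'p ^ 'n \<Rightarrow> real ^ 'p ^ 'n"
  where "tildeN G_N X = adjoint (ProjN X) \<circ> G_N X \<circ> ProjN X"

definition tildeT_inv ::
    "(real ^ 'p ^ 'n \<Rightarrow> real ^ 'p ^ 'n \<Rightarrow> real ^ 'p ^ 'n) \<Rightarrow>
     real ^ 'p ^ 'n \<Rightarrow> real ^ 'p ^ 'n \<Rightarrow> real ^ 'p ^ 'n"
  where "tildeT_inv G_T X = inv_into (tangentSt X) (tildeT G_T X)"

definition tildeN_inv ::
    "(real ^ 'p ^ 'n \<Rightarrow> real ^ 'p ^ 'n \<Rightarrow> real ^ 'p ^ 'n) \<Rightarrow>
     real ^ 'p ^ 'n \<Rightarrow> real ^ 'p ^ 'n \<Rightarrow> real ^ 'p ^ 'n"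
  where "tildeN_inv G_N X = inv_into (normalSt X) (tildeN G_N X)"

definition landing_metric ::
    "(real ^ 'p ^ 'n \<Rightarrow> real ^ 'p ^ 'n \<Rightarrow> real ^ 'p ^ 'n) \<Rightarrow>
     (real ^ 'p ^ 'n \<Rightarrow> real ^ 'p ^ 'n \<Rightarrow> real ^ 'p ^ 'n) \<Rightarrow>
     real ^ 'p ^ 'n \<Rightarrow> real ^ 'p ^ 'n \<Rightarrow> real ^ 'p ^ 'n \<Rightarrow> real"
  where "landing_metric G_T G_N X \<xi> \<zeta> =
    tildeT G_T X (ProjT X \<xi>) \<bullet> \<zeta> + tildeN G_N X (ProjN X \<xi>) \<bullet> \<zeta>"

text \<open>In the following, \<open>g\<close> is the bilinear form on the matrix space at the point \<open>X\<close>; the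
  Frobenius case is \<open>g = (\<bullet>)\<close>.\<close>

definition gradSt ::
    "(real ^ 'p ^ 'n \<Rightarrow> real ^ 'p ^ 'n \<Rightarrow> real) \<Rightarrow>
     (real ^ 'p ^ 'n \<Rightarrow> real) \<Rightarrow> real ^ 'p ^ 'n \<Rightarrow> real ^ 'p ^ 'n"
  where "gradSt g f X =
    (THE v. v \<in> tangentSt X \<and> (\<forall>\<xi>\<in>tangentSt X. g v \<xi> = frechet_derivative f (at X) \<xi>))"

definition Dc_adj ::
    "(real ^ 'p ^ 'n \<Rightarrow> real ^ 'p ^ 'n \<Rightarrow> real) \<Rightarrow>
     real ^ 'p ^ 'n \<Rightarrow> real ^ 'p ^ 'p \<Rightarrow> real ^ 'p ^ 'n"
  where "Dc_adj g X S = (THE v. \<forall>\<xi>. Dc X \<xi> \<bullet> S = g \<xi> v)"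

text \<open>\<open>Dc X \<circ> Dc_adj g X\<close> is an operator on the symmetric matrices and is inverted there.\<close>

definition Dc_pinv ::
    "(real ^ 'p ^ 'n \<Rightarrow> real ^ 'p ^ 'n \<Rightarrow> real) \<Rightarrow>
     real ^ 'p ^ 'n \<Rightarrow> real ^ 'p ^ 'p \<Rightarrow> real ^ 'p ^ 'n"
  where "Dc_pinv g X = Dc_adj g X \<circ> inv_into SymM (Dc X \<circ> Dc_adj g X)"

definition landing_dT ::
    "(real ^ 'p ^ 'n \<Rightarrow> real ^ 'p ^ 'n \<Rightarrow> real) \<Rightarrow>
     (real ^ 'p ^ 'n \<Rightarrow> real) \<Rightarrow> real ^ 'p ^ 'n \<Rightarrow> real ^ 'p ^ 'n"
  where "landing_dT g f X = - gradSt g f X"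

definition landing_dN ::
    "(real ^ 'p ^ 'n \<Rightarrow> real ^ 'p ^ 'n \<Rightarrow> real) \<Rightarrow>
     (real ^ 'p ^ 'n \<Rightarrow> real ^ 'p ^ 'p \<Rightarrow> real ^ 'p ^ 'p) \<Rightarrow>
     real ^ 'p ^ 'n \<Rightarrow> real ^ 'p ^ 'n"
  where "landing_dN g H X = - Dc_pinv g X (H X (constr X))"

end

theory Submission
  imports Defs
begin

text \<open>\<open>ProjN X = X (X\<^sup>T X)\<^sup>-\<^sup>1 Dc X\<close> and \<open>ProjT X = id - ProjN X\<close>, so the normal space is a complement of
  the tangent space \<open>ker (Dc X)\<close>, and the two are orthogonal for the landing metric. The tangent
  part of the metric is represented by \<open>tildeT\<close>, which turns the equation for the gradient into
  \<open>tildeT v = ProjT\<^sup>* (gradE f X)\<close>. On the other side, the image of the adjoint of \<open>Dc X\<close> is the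
  normal space whatever the normal operator, so the pseudoinverse of \<open>Dc X\<close> is the metric-free
  map \<open>T \<mapsto> X (X\<^sup>T X)\<^sup>-\<^sup>1 T\<close>.\<close>

section \<open>Matrix algebra and Frobenius adjoints\<close>

lemma matrix_diff_ldistrib: "A ** (B - C) = A ** B - A ** (C :: real ^ 'k ^ 'm)"
  using matrix_add_ldistrib[of A "B - C" C] by (simp add: eq_diff_eq)

lemma matrix_add_rdistrib: "(A + B) ** C = A ** C + B ** (C :: real ^ 'k ^ 'm)"
  by (vector matrix_matrix_mult_def sum.distrib[symmetric] field_simps)

lemma matrix_diff_rdistrib: "(A - B) ** C = A ** C - B ** (C :: real ^ 'k ^ 'm)"
  using matrix_add_rdistrib[of "A - B" B C] by (simp add: eq_diff_eq)

lemma transpose_add: "transpose (A + B) = transpose A + transpose (B :: real ^ 'k ^ 'm)"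
  by (simp add: transpose_def vec_eq_iff)

lemma transpose_diff: "transpose (A - B) = transpose A - transpose (B :: real ^ 'k ^ 'm)"
  by (simp add: transpose_def vec_eq_iff)

lemma scaleR_matrix_mult: "(k *\<^sub>R A) ** B = k *\<^sub>R (A ** (B :: real ^ 'k ^ 'm))"
  by (simp add: scalar_matrix_assoc)

lemma matrix_mult_scaleR: "A ** (k *\<^sub>R B) = k *\<^sub>R (A ** (B :: real ^ 'k ^ 'm))"
  by (simp add: matrix_scalar_ac scalar_matrix_assoc)

lemmas matrix_linear_simps = matrix_add_ldistrib matrix_add_rdistrib matrix_diff_ldistrib
  matrix_diff_rdistrib transpose_add transpose_diff scaleR_matrix_mult matrix_mult_scaleR
  transpose_scalar

lemma linear_matrix_mult_left: "linear (\<lambda>B :: real ^ 'k ^ 'm. A ** B)"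
  by (rule linearI) (simp_all add: matrix_linear_simps)

lemma bounded_bilinear_matrix_mult:
  "bounded_bilinear (\<lambda>(A :: real ^ 'm ^ 'l) (B :: real ^ 'k ^ 'm). A ** B)"
  unfolding bilinear_conv_bounded_bilinear[symmetric] bilinear_def
  by (auto intro!: linearI simp: matrix_linear_simps)

lemma linear_transpose: "linear (transpose :: real ^ 'k ^ 'm \<Rightarrow> real ^ 'm ^ 'k)"
  by (rule linearI) (simp_all add: matrix_linear_simps)

lemma inner_matrix_mult_left:
  fixes A :: "real ^ 'm ^ 'l" and B :: "real ^ 'k ^ 'm"
  shows "(A ** B) \<bullet> C = B \<bullet> (transpose A ** C)"
  by (simp add: frobenius_inner matrix_transpose_mul matrix_mul_assoc)

lemma inner_transpose:
  fixes A B :: "real ^ 'k ^ 'm"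
  shows "transpose A \<bullet> transpose B = A \<bullet> B"
  unfolding frobenius_inner by (metis frobenius_inner inner_commute trace_mul_sym transpose_transpose)

lemma linear_msym: "linear msym"
  by (rule linearI) (simp_all add: msym_def matrix_linear_simps algebra_simps)

lemma msym_SymM: "msym A \<in> SymM"
  by (simp add: SymM_def msym_def matrix_linear_simps add.commute)

lemma msym_id: "S \<in> SymM \<Longrightarrow> msym S = S"
  by (simp add: SymM_def msym_def scaleR_2[symmetric])

lemma msym_plus_mskew: "msym A + mskew A = A"
  by (simp add: msym_def mskew_def algebra_simps flip: scaleR_add_left)

lemma inner_msym: "msym A \<bullet> B = A \<bullet> msym B"
proof -
  have "transpose A \<bullet> B = A \<bullet> transpose B"
    by (metis inner_transpose transpose_transpose)
  then show ?thesis
    by (simp add: msym_def inner_left_distrib inner_right_distrib)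
qed

lemma inner_mskew: "mskew A \<bullet> B = A \<bullet> mskew B"
proof -
  have "transpose A \<bullet> B = A \<bullet> transpose B"
    by (metis inner_transpose transpose_transpose)
  then show ?thesis
    by (simp add: mskew_def inner_diff_left inner_diff_right)
qed

lemma matrix_inv_inverse:
  assumes "invertible (A :: real ^ 'k ^ 'k)"
  shows "A ** matrix_inv A = mat 1" and "matrix_inv A ** A = mat 1"
  using someI_ex[OF assms[unfolded invertible_def]] unfolding matrix_inv_def by auto

section \<open>Operators compressed by an oblique projector\<close>

lemma symmetric_operator_on_UNIV_D:
  assumes "symmetric_operator_on UNIV A"
  shows "linear A" and "A x \<bullet> y = x \<bullet> A y"
  using assms by (auto simp: symmetric_operator_on_def intro: linearI)

text \<open>Common shape of \<open>tildeT\<close> and \<open>tildeN\<close>. Injectivity follows by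
  pairing with \<open>x - y\<close> and using definiteness of \<open>G\<close> on
  \<open>range P\<close>. Surjectivity onto \<open>range (adjoint P)\<close> comes from solving with
  the operator \<open>A\<close> on the whole space.\<close>

lemma bij_betw_sandwich:
  fixes P G :: "'a::euclidean_space \<Rightarrow> 'a"
  assumes P: "linear P" "\<And>x. P (P x) = P x"
    and G: "symmetric_operator_on UNIV G" "pos_def_on (range P) G"
  shows "bij_betw (adjoint P \<circ> G \<circ> P) (range P) (range (adjoint P))"
proof -
  note linG = symmetric_operator_on_UNIV_D(1)[OF G(1)]
  define Q where "Q x = x - P x" for x
  \<comment> \<open>Adding a definite form on the kernel of \<open>P\<close> makes the operator invertible on the whole space.\<close>
  define A where "A x = adjoint P (G (P x)) + adjoint Q (Q x)" for x
  note linP' = adjoint_linear[OF P(1)]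
  have linQ: "linear Q"
    unfolding Q_def by (intro linear_compose_sub linear_ident P(1))
  note linQ' = adjoint_linear[OF linQ]
  have linA: "linear A"
    unfolding A_def
    by (intro linear_compose_add linear_compose[OF P(1), unfolded o_def]
        linear_compose[OF linG, unfolded o_def] linear_compose[OF linQ, unfolded o_def] linP' linQ')
  have inner_A: "x \<bullet> A y = P x \<bullet> G (P y) + Q x \<bullet> Q y" for x y
    by (simp add: A_def inner_add_right adjoint_works[OF P(1)] adjoint_works[OF linQ])
  have pos: "P x = 0" if "P x \<bullet> G (P x) \<le> 0" for x
    using G(2) that unfolding pos_def_on_def by (metis inner_commute not_le rangeI)
  have nonneg: "P x \<bullet> G (P x) \<ge> 0" for x
    by (metis pos inner_zero_left linear order.refl)
  have "inj A"
    unfolding linear_injective_0[OF linA]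
  proof (intro allI impI)
    fix x assume "A x = 0"
    then have *: "P x \<bullet> G (P x) + Q x \<bullet> Q x = 0"
      using inner_A[of x x] by simp
    then have "P x = 0"
      by (intro pos) (metis add_le_same_cancel1 inner_ge_zero add.commute le_add_same_cancel1)
    moreover from this * have "Q x = 0"
      by simp
    ultimately show "x = 0"
      by (simp add: Q_def)
  qed
  then have "surj A"
    using linear_injective_imp_surjective[OF linA] by simp
  have PQ: "P (Q x) = 0" "Q (P x) = 0" for x
    using P by (simp_all add: Q_def linear_diff)
  have "inj_on (adjoint P \<circ> G \<circ> P) (range P)"
  proof (rule inj_onI)
    fix x y assume xy: "x \<in> range P" "y \<in> range P"
      and eq: "(adjoint P \<circ> G \<circ> P) x = (adjoint P \<circ> G \<circ> P) y"
    have fixp: "P x = x" "P y = y"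
      using xy P(2) by auto
    have "(x - y) \<bullet> (adjoint P \<circ> G \<circ> P) x = (x - y) \<bullet> (adjoint P \<circ> G \<circ> P) y"
      using eq by simp
    then have "P (x - y) \<bullet> G (P (x - y)) = 0"
      by (simp add: adjoint_works[OF P(1)] fixp linear_diff[OF P(1)] linear_diff[OF linG]
          inner_diff_right)
    then show "x = y"
      using pos[of "x - y"] by (simp add: fixp linear_diff[OF P(1)])
  qed
  moreover have "w \<in> (adjoint P \<circ> G \<circ> P) ` range P" if w: "w \<in> range (adjoint P)" for w
  proof -
    obtain z where z: "w = adjoint P z"
      using w by blast
    obtain y where y: "A y = w"
      using \<open>surj A\<close> by (metis surjD)
    \<comment> \<open>Testing \<open>A y = w\<close> against \<open>P x\<close> removes the
      \<open>Q\<close> part because \<open>Q (P x) = 0\<close>; since \<open>w\<close> lies in the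
      range of \<open>adjoint P\<close>, pairing it with \<open>P x\<close> or with \<open>x\<close>
      gives the same value.\<close>
    have "x \<bullet> adjoint P (G (P (P y))) = x \<bullet> w" for x
    proof -
      have "P x \<bullet> A y = P x \<bullet> w"
        by (simp add: y)
      then show ?thesis
        by (simp add: inner_A PQ P(2) z adjoint_works[OF P(1)])
    qed
    then have "adjoint P (G (P (P y))) = w"
      by (metis vector_eq_ldot)
    then show ?thesis
      by force
  qed
  ultimately show ?thesis
    by (auto simp: bij_betw_def)
qed

section \<open>Derivative of the constraint and the two projectors\<close>

lemma has_derivative_constr: "(constr has_derivative (\<lambda>\<xi>. msym (transpose X ** \<xi>))) (at X)"
proof -
  have T: "(transpose has_derivative transpose) (at X)"
    using linear_transpose linear_conv_bounded_linear bounded_linear_imp_has_derivative by blast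
  have "((\<lambda>X. (1/2) *\<^sub>R (transpose X ** X - mat 1)) has_derivative
      (\<lambda>\<xi>. (1/2) *\<^sub>R (transpose X ** \<xi> + transpose \<xi> ** X - 0))) (at X)"
    by (intro has_derivative_scaleR_right has_derivative_diff has_derivative_const
        bounded_bilinear.FDERIV[OF bounded_bilinear_matrix_mult] T has_derivative_ident)
  then show ?thesis
    by (simp add: constr_def[abs_def] msym_def matrix_transpose_mul)
qed

lemma Dc_eq: "Dc X \<xi> = msym (transpose X ** \<xi>)"
  unfolding Dc_def frechet_derivative_at[OF has_derivative_constr, symmetric] ..

lemma linear_Dc: "linear (Dc X)"
  unfolding Dc_eq[abs_def]
  using linear_compose[OF linear_matrix_mult_left linear_msym] by (simp add: o_def)

lemma Dc_SymM: "Dc X \<xi> \<in> SymM"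
  by (simp add: Dc_eq msym_SymM)

text \<open>Identifies the Frobenius adjoint of \<open>Dc X\<close>; the \<open>msym\<close> on the
  right makes the formula valid for every square \<open>S\<close>, as \<open>Dc_adj\<close> is a
  total function.\<close>

lemma inner_Dc: "Dc X \<xi> \<bullet> S = \<xi> \<bullet> (X ** msym S)"
  by (simp add: Dc_eq inner_msym inner_matrix_mult_left)

lemma tangentSt_iff: "\<xi> \<in> tangentSt X \<longleftrightarrow> Dc X \<xi> = 0"
  by (simp add: tangentSt_def Dc_eq msym_def matrix_transpose_mul add.commute)

lemma ProjN_eq: "ProjN X Z = X ** gram_inv X ** Dc X Z"
  by (simp add: ProjN_def Dc_eq)

text \<open>Replacing the skew part of \<open>transpose X ** Z\<close> by the whole minus its
  symmetric part makes the terms \<open>X ** gram_inv X ** transpose X ** Z\<close> cancel.\<close>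

lemma ProjT_eq: "ProjT X Z = Z - ProjN X Z"
proof -
  have "X ** gram_inv X ** mskew (transpose X ** Z) =
      X ** gram_inv X ** transpose X ** Z - ProjN X Z"
    using msym_plus_mskew[of "transpose X ** Z"]
    by (metis ProjN_def add_diff_cancel_left' matrix_add_ldistrib matrix_mul_assoc)
  then show ?thesis
    by (simp add: ProjT_def matrix_linear_simps matrix_mul_assoc)
qed

lemma linear_ProjN: "linear (ProjN X)"
  unfolding ProjN_eq[abs_def]
  using linear_compose[OF linear_Dc linear_matrix_mult_left] by (simp add: o_def)

lemma linear_ProjT: "linear (ProjT X)"
  unfolding ProjT_eq[abs_def] by (intro linear_compose_sub linear_ident linear_ProjN)

lemma constr_SymM: "constr X \<in> SymM"
  by (simp add: SymM_def constr_def matrix_linear_simps matrix_transpose_mul)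

lemma gradE_inner:
  assumes "f differentiable at X"
  shows "frechet_derivative f (at X) \<xi> = gradE f X \<bullet> \<xi>"
proof -
  \<comment> \<open>The adjoint of a linear functional sends 1 to its Riesz representative.\<close>
  define D where "D = adjoint (frechet_derivative f (at X)) 1"
  note der = assms[unfolded frechet_derivative_works]
  have D: "frechet_derivative f (at X) h = h \<bullet> D" for h
    using adjoint_works[OF linear_frechet_derivative[OF assms], of h 1] by (simp add: D_def)
  have GD: "GDERIV f X :> D"
    using der by (simp add: gderiv_def D[symmetric])
  have "gradE f X = D"
    unfolding gradE_def
  proof (rule the_equality[where P = "\<lambda>D. GDERIV f X :> D", OF GD])
    fix D' assume "GDERIV f X :> D'"
    then have "(\<lambda>h. h \<bullet> D') = (\<lambda>h. h \<bullet> D)"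
      using GD unfolding gderiv_def by (rule has_derivative_unique)
    then show "D' = D"
      by (metis vector_eq_ldot)
  qed
  then show ?thesis
    by (simp add: D inner_commute)
qed

section \<open>Full column rank: the splitting into tangent and normal spaces\<close>

locale full_column_rank =
  fixes X :: "real ^ 'p ^ 'n"
  assumes rank: "rank X = CARD('p)"
begin

lemma left_cancel: "X ** A = X ** B \<Longrightarrow> A = B"
proof -
  obtain L where "L ** X = mat 1"
    using rank full_rank_injective matrix_left_invertible_injective by blast
  then show "X ** A = X ** B \<Longrightarrow> A = B"
    by (metis matrix_mul_assoc matrix_mul_lid)
qed

text \<open>A vector in the kernel of \<open>transpose X ** X\<close> satisfies
  \<open>(X *v v) \<bullet> (X *v v) = 0\<close>, and \<open>X\<close> is injective by full
  rank.\<close>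

lemma gram_inverse:
  "transpose X ** X ** gram_inv X = mat 1" "gram_inv X ** (transpose X ** X) = mat 1"
proof -
  have "inj ((*v) (transpose X ** X))"
    unfolding linear_injective_0[OF matrix_vector_mul_linear]
  proof (intro allI impI)
    fix v assume "transpose X ** X *v v = 0"
    then have "(X *v v) \<bullet> (X *v v) = 0"
      by (metis dot_lmul_matrix inner_zero_left matrix_vector_mul_assoc transpose_matrix_vector)
    then have "X *v v = X *v 0"
      by simp
    then show "v = 0"
      using rank unfolding full_rank_injective by (rule injD[rotated])
  qed
  then have "invertible (transpose X ** X)"
    using matrix_left_invertible_injective invertible_left_inverse by blast
  then show "transpose X ** X ** gram_inv X = mat 1" "gram_inv X ** (transpose X ** X) = mat 1"
    unfolding gram_inv_def by (rule matrix_inv_inverse)+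
qed

lemma transpose_gram_inv: "transpose (gram_inv X) = gram_inv X"
  by (metis gram_inverse matrix_transpose_mul transpose_mat transpose_transpose matrix_mul_assoc
      matrix_mul_lid matrix_mul_rid)

lemma transpose_mult_lift: "transpose X ** (X ** gram_inv X ** S) = S"
  by (simp add: matrix_mul_assoc gram_inverse)

text \<open>The right inverse of \<open>Dc X\<close> with values in the normal space; it turns out
  to be the pseudoinverse for every landing metric.\<close>

lemma Dc_lift: "S \<in> SymM \<Longrightarrow> Dc X (X ** gram_inv X ** S) = S"
  by (simp add: Dc_eq transpose_mult_lift msym_id)

lemma Dc_ProjN: "Dc X (ProjN X Z) = Dc X Z"
  by (simp add: ProjN_eq Dc_lift Dc_SymM)

lemma Dc_ProjT: "Dc X (ProjT X Z) = 0"
  by (simp add: ProjT_eq linear_diff[OF linear_Dc] Dc_ProjN)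

lemma ProjN_tangent: "\<xi> \<in> tangentSt X \<Longrightarrow> ProjN X \<xi> = 0"
  by (simp add: tangentSt_iff ProjN_eq)

lemma ProjT_tangent: "\<xi> \<in> tangentSt X \<Longrightarrow> ProjT X \<xi> = \<xi>"
  by (simp add: ProjT_eq ProjN_tangent)

lemma ProjN_normal: "\<nu> \<in> normalSt X \<Longrightarrow> ProjN X \<nu> = \<nu>"
  by (auto simp: normalSt_def ProjN_eq Dc_lift)

lemma ProjT_normal: "\<nu> \<in> normalSt X \<Longrightarrow> ProjT X \<nu> = 0"
  by (simp add: ProjT_eq ProjN_normal)

lemma ProjT_in: "ProjT X Z \<in> tangentSt X"
  by (simp add: tangentSt_iff Dc_ProjT)

lemma ProjN_in: "ProjN X Z \<in> normalSt X"
  using Dc_SymM by (auto simp: normalSt_def ProjN_eq)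

lemma range_ProjT: "range (ProjT X) = tangentSt X"
  by (metis ProjT_in ProjT_tangent image_subset_iff rangeI subsetI subset_antisym)

lemma range_ProjN: "range (ProjN X) = normalSt X"
  by (metis ProjN_in ProjN_normal image_subset_iff rangeI subsetI subset_antisym)

lemma adjoint_ProjN: "adjoint (ProjN X) = (\<lambda>W. X ** msym (gram_inv X ** transpose X ** W))"
  by (rule adjoint_unique)
    (simp add: ProjN_eq inner_matrix_mult_left inner_Dc matrix_transpose_mul transpose_gram_inv
      matrix_mul_assoc inner_msym)

text \<open>At \<open>gradE f X\<close> the right-hand side is the bracket in the formula for the
  tangent direction.\<close>

lemma adjoint_ProjT: "adjoint (ProjT X) =
    (\<lambda>W. X ** mskew (gram_inv X ** transpose X ** W)
      + (mat 1 - X ** gram_inv X ** transpose X) ** W)"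
proof (rule adjoint_unique, intro allI)
  fix Z W
  have "ProjT X Z \<bullet> W = mskew (transpose X ** Z) \<bullet> (gram_inv X ** transpose X ** W)
      + Z \<bullet> (transpose (mat 1 - X ** gram_inv X ** transpose X) ** W)"
    by (simp add: ProjT_def inner_add_left inner_matrix_mult_left matrix_transpose_mul
        transpose_gram_inv)
  also have "mskew (transpose X ** Z) \<bullet> (gram_inv X ** transpose X ** W)
      = Z \<bullet> (X ** mskew (gram_inv X ** transpose X ** W))"
    by (simp add: inner_mskew inner_matrix_mult_left)
  finally show "ProjT X Z \<bullet> W = Z \<bullet> (X ** mskew (gram_inv X ** transpose X ** W)
      + (mat 1 - X ** gram_inv X ** transpose X) ** W)"
    by (simp add: inner_add_right matrix_linear_simps matrix_transpose_mul transpose_gram_inv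
        matrix_mul_assoc)
qed

text \<open>Places \<open>X ** S\<close> in the codomain of \<open>tildeN\<close>, so that
  \<open>tildeN_inv\<close> is meaningful there.\<close>

lemma adjoint_ProjN_mult_sym: "S \<in> SymM \<Longrightarrow> adjoint (ProjN X) (X ** S) = X ** S"
proof -
  assume S: "S \<in> SymM"
  have "gram_inv X ** transpose X ** (X ** S) = S"
    by (metis gram_inverse(2) matrix_mul_assoc matrix_mul_lid)
  then show ?thesis
    by (simp only: adjoint_ProjN msym_id[OF S])
qed

text \<open>The Lyapunov operator \<open>L\<close> is injective on all square matrices, since
  \<open>L S \<bullet> S\<close> is half the sum of the squared norms of \<open>X ** S\<close> and
  \<open>X ** transpose S\<close>. It is therefore bijective.\<close>

lemma sylvester_ex1:
  fixes T :: "real ^ 'p ^ 'p"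
  assumes "T \<in> SymM"
  shows "\<exists>!S. S \<in> SymM \<and> (1/2) *\<^sub>R (transpose X ** X ** S + S ** transpose X ** X) = T"
proof -
  define L where "L S = (1/2) *\<^sub>R (transpose X ** X ** S + S ** transpose X ** X)"
    for S :: "real ^ 'p ^ 'p"
  have linL: "linear L"
    unfolding L_def by (rule linearI) (simp_all add: matrix_linear_simps algebra_simps)
  have L_transpose: "L (transpose S) = transpose (L S)" for S
    by (simp add: L_def matrix_linear_simps matrix_transpose_mul matrix_mul_assoc add.commute)
  have "inj L"
    unfolding linear_injective_0[OF linL]
  proof (intro allI impI)
    fix S assume "L S = 0"
    have half: "(transpose X ** X ** A) \<bullet> A = (X ** A) \<bullet> (X ** A)" for A :: "real ^ 'p ^ 'p"
      by (simp add: inner_matrix_mult_left matrix_transpose_mul matrix_mul_assoc)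
    have "(S ** transpose X ** X) \<bullet> S = (transpose X ** X ** transpose S) \<bullet> transpose S"
      by (subst inner_transpose[symmetric]) (simp add: matrix_transpose_mul matrix_mul_assoc)
    then have "2 * (L S \<bullet> S) = (X ** S) \<bullet> (X ** S) + (X ** transpose S) \<bullet> (X ** transpose S)"
      by (simp add: L_def inner_add_left half)
    then have "(X ** S) \<bullet> (X ** S) + (X ** transpose S) \<bullet> (X ** transpose S) = 0"
      using \<open>L S = 0\<close> by simp
    then have "X ** S = X ** 0"
      by (simp add: add_nonneg_eq_0_iff)
    then show "S = 0"
      by (rule left_cancel)
  qed
  then have "surj L"
    using linear_injective_imp_surjective[OF linL] by simp
  then obtain S where S: "L S = T"
    by (metis surjD)
  \<comment> \<open>\<open>L\<close> commutes with transposition, so \<open>transpose S\<close>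
    solves the same equation and injectivity makes \<open>S\<close> symmetric.\<close>
  have "L (transpose S) = L S"
    using assms by (simp add: L_transpose S SymM_def)
  then have "S \<in> SymM"
    by (simp add: SymM_def inj_eq[OF \<open>inj L\<close>])
  then show ?thesis
    unfolding L_def[symmetric] using S injD[OF \<open>inj L\<close>] by (intro ex1I[of _ S]) simp_all
qed

end

section \<open>The landing metric, its gradient and the pseudoinverse of \<open>Dc X\<close>\<close>

locale landing = full_column_rank X
  for X :: "real ^ 'p ^ 'n" +
  fixes G_T G_N :: "real ^ 'p ^ 'n \<Rightarrow> real ^ 'p ^ 'n \<Rightarrow> real ^ 'p ^ 'n"
  assumes G_T: "symmetric_operator_on UNIV (G_T X)" "pos_def_on (tangentSt X) (G_T X)"
    and G_N: "symmetric_operator_on UNIV (G_N X)" "pos_def_on (normalSt X) (G_N X)"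
begin

abbreviation g where "g \<equiv> landing_metric G_T G_N X"

text \<open>The range of \<open>adjoint (ProjT X)\<close> is the orthogonal complement of the kernel
  of \<open>ProjT X\<close>, that is, of \<open>normalSt X\<close>. The analogous description holds
  for \<open>tildeN\<close>.\<close>

lemma bij_betw_tildeT: "bij_betw (tildeT G_T X) (tangentSt X) (range (adjoint (ProjT X)))"
  unfolding tildeT_def range_ProjT[symmetric] using G_T
  by (intro bij_betw_sandwich linear_ProjT) (simp_all add: ProjT_tangent ProjT_in range_ProjT)

lemma bij_betw_tildeN: "bij_betw (tildeN G_N X) (normalSt X) (range (adjoint (ProjN X)))"
  unfolding tildeN_def range_ProjN[symmetric] using G_N
  by (intro bij_betw_sandwich linear_ProjN) (simp_all add: ProjN_normal ProjN_in range_ProjN)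

lemma tildeT_inv:
  "tildeT_inv G_T X (adjoint (ProjT X) W) \<in> tangentSt X"
  "tildeT G_T X (tildeT_inv G_T X (adjoint (ProjT X) W)) = adjoint (ProjT X) W"
  using bij_betw_inv_into_right[OF bij_betw_tildeT]
    bij_betwE[OF bij_betw_inv_into[OF bij_betw_tildeT]] by (auto simp: tildeT_inv_def)

lemma tildeN_inv:
  assumes "S \<in> SymM"
  shows "tildeN_inv G_N X (X ** S) \<in> normalSt X"
    and "tildeN G_N X (tildeN_inv G_N X (X ** S)) = X ** S"
proof -
  have "X ** S \<in> range (adjoint (ProjN X))"
    by (metis adjoint_ProjN_mult_sym[OF assms] rangeI)
  then show "tildeN_inv G_N X (X ** S) \<in> normalSt X"
    "tildeN G_N X (tildeN_inv G_N X (X ** S)) = X ** S"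
    using bij_betw_inv_into_right[OF bij_betw_tildeN]
      bij_betwE[OF bij_betw_inv_into[OF bij_betw_tildeN]] by (auto simp: tildeN_inv_def)
qed

lemma tildeN_inv_eq: "\<nu> \<in> normalSt X \<Longrightarrow> tildeN G_N X \<nu> = W \<Longrightarrow> tildeN_inv G_N X W = \<nu>"
  using bij_betw_inv_into_left[OF bij_betw_tildeN] by (auto simp: tildeN_inv_def)

text \<open>Idempotence and moving the adjoints to the second argument exhibit the metric as block
  diagonal; symmetry and definiteness can then be checked on each block.\<close>

lemma metric_eq:
  "g \<xi> \<zeta> = G_T X (ProjT X \<xi>) \<bullet> ProjT X \<zeta> + G_N X (ProjN X \<xi>) \<bullet> ProjN X \<zeta>"
  by (simp add: landing_metric_def tildeT_def tildeN_def adjoint_clauses[OF linear_ProjT]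
      adjoint_clauses[OF linear_ProjN] ProjT_tangent ProjT_in ProjN_normal ProjN_in)

lemma metric_diff_right: "g \<xi> (\<zeta> - \<eta>) = g \<xi> \<zeta> - g \<xi> \<eta>"
  by (simp add: landing_metric_def inner_diff_right)

lemma metric_commute: "g \<xi> \<zeta> = g \<zeta> \<xi>"
  unfolding metric_eq
  using symmetric_operator_on_UNIV_D(2)[OF G_T(1)] symmetric_operator_on_UNIV_D(2)[OF G_N(1)]
  by (metis inner_commute)

lemma metric_tangent: "\<xi> \<in> tangentSt X \<Longrightarrow> g \<xi> \<zeta> = tildeT G_T X \<xi> \<bullet> \<zeta>"
  using linear_0[OF symmetric_operator_on_UNIV_D(1)[OF G_N(1)]]
  by (simp add: metric_eq tildeT_def adjoint_clauses[OF linear_ProjT] ProjN_tangent)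

lemma metric_normal: "\<nu> \<in> normalSt X \<Longrightarrow> g \<nu> \<zeta> = tildeN G_N X \<nu> \<bullet> \<zeta>"
  using linear_0[OF symmetric_operator_on_UNIV_D(1)[OF G_T(1)]]
  by (simp add: metric_eq tildeN_def adjoint_clauses[OF linear_ProjN] ProjT_normal)

text \<open>Supplies the uniqueness behind the definite descriptions \<open>gradSt\<close> and
  \<open>Dc_adj\<close>.\<close>

lemma metric_definite: "g \<xi> \<xi> = 0 \<Longrightarrow> \<xi> = 0"
proof -
  assume "g \<xi> \<xi> = 0"
  moreover have "G_T X (ProjT X \<xi>) \<bullet> ProjT X \<xi> > 0" if "ProjT X \<xi> \<noteq> 0"
    using that G_T(2) ProjT_in by (auto simp: pos_def_on_def)
  moreover have "G_N X (ProjN X \<xi>) \<bullet> ProjN X \<xi> > 0" if "ProjN X \<xi> \<noteq> 0"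
    using that G_N(2) ProjN_in by (auto simp: pos_def_on_def)
  ultimately have "ProjT X \<xi> = 0 \<and> ProjN X \<xi> = 0"
    unfolding metric_eq by (smt (verit) inner_zero_right)
  then show "\<xi> = 0"
    by (metis ProjT_eq diff_zero)
qed

text \<open>On tangent vectors \<open>ProjT X\<close> is the identity, so pairing with
  \<open>adjoint (ProjT X) (gradE f X)\<close> agrees with pairing with \<open>gradE f X\<close>;
  the former is what \<open>tildeT\<close> can represent.\<close>

lemma gradSt_eq:
  assumes "f differentiable at X"
  shows "gradSt g f X = tildeT_inv G_T X (adjoint (ProjT X) (gradE f X))"
    (is "_ = ?v")
  unfolding gradSt_def
proof (rule the_equality)
  have "g ?v \<xi> = frechet_derivative f (at X) \<xi>" if "\<xi> \<in> tangentSt X" for \<xi>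
    using that
    by (simp add: metric_tangent tildeT_inv adjoint_clauses[OF linear_ProjT] ProjT_tangent
        gradE_inner[OF assms])
  then show *: "?v \<in> tangentSt X \<and> (\<forall>\<xi>\<in>tangentSt X. g ?v \<xi> = frechet_derivative f (at X) \<xi>)"
    by (simp add: tildeT_inv)
  fix v assume v: "v \<in> tangentSt X \<and> (\<forall>\<xi>\<in>tangentSt X. g v \<xi> = frechet_derivative f (at X) \<xi>)"
  have "v - ?v \<in> tangentSt X"
    using v * by (simp add: tangentSt_iff linear_diff[OF linear_Dc])
  \<comment> \<open>Both candidates give the same pairing with every tangent vector, in particular
    with their own difference.\<close>
  then have "g (v - ?v) (v - ?v) = 0"
    using v * metric_diff_right[of "v - ?v" v ?v] by (metis diff_self metric_commute)
  then show "v = ?v"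
    using metric_definite by fastforce
qed

text \<open>By \<open>inner_Dc\<close> the functional to represent is the Frobenius pairing with
  \<open>X ** msym S\<close>, and on normal vectors the metric is the Frobenius pairing with their
  image under \<open>tildeN\<close>.\<close>

lemma Dc_adj_eq: "Dc_adj g X S = tildeN_inv G_N X (X ** msym S)" (is "_ = ?v")
  unfolding Dc_adj_def
proof (rule the_equality)
  show *: "\<forall>\<xi>. Dc X \<xi> \<bullet> S = g \<xi> ?v"
    by (metis inner_Dc inner_commute metric_commute metric_normal msym_SymM tildeN_inv)
  fix v assume v: "\<forall>\<xi>. Dc X \<xi> \<bullet> S = g \<xi> v"
  have "g (v - ?v) (v - ?v) = 0"
    using v * by (metis diff_self metric_diff_right)
  then show "v = ?v"
    using metric_definite by fastforce
qed

lemma Dc_adj_normal: "Dc_adj g X S \<in> normalSt X"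
  by (simp add: Dc_adj_eq tildeN_inv msym_SymM)

text \<open>Whatever preimage of \<open>T\<close> is chosen by \<open>inv_into\<close>, its image
  under \<open>Dc_adj g X\<close> is a normal vector with \<open>Dc X\<close> value
  \<open>T\<close>, and a normal vector is determined by that value through
  \<open>ProjN_eq\<close>.\<close>

lemma Dc_pinv_eq:
  assumes "T \<in> SymM"
  shows "Dc_pinv g X T = X ** gram_inv X ** T"
proof -
  let ?u = "X ** gram_inv X ** T"
  have u: "?u \<in> normalSt X"
    using assms by (auto simp: normalSt_def)
  \<comment> \<open>The values of \<open>tildeN\<close> lie in the range of
    \<open>adjoint (ProjN X)\<close>, whose explicit form is \<open>X\<close> times a symmetric
    matrix.\<close>
  obtain S where S: "S \<in> SymM" "tildeN G_N X ?u = X ** S"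
    by (metis adjoint_ProjN comp_apply msym_SymM tildeN_def)
  have "Dc_adj g X S = ?u"
    using tildeN_inv_eq[OF u S(2)] S(1) by (simp add: Dc_adj_eq msym_id)
  then have "T \<in> (Dc X \<circ> Dc_adj g X) ` SymM"
    using S(1) Dc_lift[OF assms] by (metis comp_apply imageI)
  then have "Dc X (Dc_pinv g X T) = T"
    using f_inv_into_f[of T "Dc X \<circ> Dc_adj g X" SymM] by (simp add: Dc_pinv_def)
  moreover have "ProjN X (Dc_pinv g X T) = Dc_pinv g X T"
    by (simp add: Dc_pinv_def Dc_adj_normal ProjN_normal)
  ultimately show ?thesis
    by (metis ProjN_eq)
qed

lemma landing_dN_eq:
  assumes "symmetric_operator_on SymM (H X)"
  shows "landing_dN g H X = - (X ** gram_inv X ** H X (constr X))"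
proof -
  have "H X (constr X) \<in> SymM"
    using assms constr_SymM by (auto simp: symmetric_operator_on_def)
  then show ?thesis
    by (simp add: landing_dN_def Dc_pinv_eq)
qed

text \<open>Serves the two cases where \<open>H X\<close> is \<open>Dc X\<close> after an adjoint:
  the pseudoinverse after \<open>Dc X\<close> is \<open>ProjN X\<close>, which fixes the normal
  vector produced by that adjoint.\<close>

lemma landing_dN_Dc_adj:
  assumes "H X (constr X) = Dc X \<nu>" and "\<nu> \<in> normalSt X"
  shows "landing_dN g H X = - \<nu>"
proof -
  have "Dc_pinv g X (Dc X \<nu>) = ProjN X \<nu>"
    by (simp only: Dc_pinv_eq[OF Dc_SymM] ProjN_eq)
  then show ?thesis
    by (simp only: landing_dN_def assms(1) ProjN_normal[OF assms(2)])
qed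

text \<open>The inverse is an \<open>inv_into\<close>, so homogeneity is derived from the linearity
  of \<open>tildeN\<close> by checking that the scaled preimage stays normal.\<close>

lemma tildeN_inv_scaleR:
  assumes "S \<in> SymM"
  shows "tildeN_inv G_N X (r *\<^sub>R (X ** S)) = r *\<^sub>R tildeN_inv G_N X (X ** S)"
proof (rule tildeN_inv_eq)
  let ?v = "tildeN_inv G_N X (X ** S)"
  show "r *\<^sub>R ?v \<in> normalSt X"
    using ProjN_in[of "r *\<^sub>R ?v"]
    by (simp add: linear_cmul[OF linear_ProjN] ProjN_normal tildeN_inv(1)[OF assms])
  have "linear (tildeN G_N X)"
    unfolding tildeN_def
    by (intro linear_compose linear_ProjN adjoint_linear symmetric_operator_on_UNIV_D(1)[OF G_N(1)])
  then show "tildeN G_N X (r *\<^sub>R ?v) = r *\<^sub>R (X ** S)"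
    by (simp add: linear_cmul tildeN_inv(2)[OF assms])
qed

end

section \<open>The Frobenius adjoint and the assembly of the formulas\<close>

lemma Dc_adj_frobenius: "S \<in> SymM \<Longrightarrow> Dc_adj (\<bullet>) X S = X ** S"
  unfolding Dc_adj_def
proof (rule the_equality)
  assume S: "S \<in> SymM"
  show "\<forall>\<xi>. Dc X \<xi> \<bullet> S = \<xi> \<bullet> (X ** S)"
    by (simp add: inner_Dc msym_id[OF S])
  show "v = X ** S" if "\<forall>\<xi>. Dc X \<xi> \<bullet> S = \<xi> \<bullet> v" for v
    using that by (simp only: inner_Dc msym_id[OF S] vector_eq_ldot)
qed

lemma SymM_gram_minus_one: "transpose X ** X - mat 1 \<in> SymM"
  by (simp add: SymM_def matrix_linear_simps matrix_transpose_mul)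

theorem proposition7p10:
  fixes X :: "real ^ 'p ^ 'n"
    and f :: "real ^ 'p ^ 'n \<Rightarrow> real"
    and G_T G_N :: "real ^ 'p ^ 'n \<Rightarrow> real ^ 'p ^ 'n \<Rightarrow> real ^ 'p ^ 'n"
    and H :: "real ^ 'p ^ 'n \<Rightarrow> real ^ 'p ^ 'p \<Rightarrow> real ^ 'p ^ 'p"
  assumes "CARD('p) \<le> CARD('n)"
    and "rank X = CARD('p)"
    and "continuously_differentiable f"
    and "symmetric_operator_on UNIV (G_T X)" and "pos_def_on (tangentSt X) (G_T X)"
    and "symmetric_operator_on UNIV (G_N X)" and "pos_def_on (normalSt X) (G_N X)"
    and "symmetric_operator_on SymM (H X)" and "pos_def_on SymM (H X)"
  shows "(landing_dT (landing_metric G_T G_N X) f X =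
      - tildeT_inv G_T X
          (X ** mskew (gram_inv X ** transpose X ** gradE f X)
            + (mat 1 - X ** gram_inv X ** transpose X) ** gradE f X))
    \<and> (\<exists>!S. S \<in> SymM \<and>
      (1/2) *\<^sub>R (transpose X ** X ** S + S ** transpose X ** X)
        = (1/2) *\<^sub>R H X (transpose X ** X - mat 1))
    \<and> (\<forall>S\<in>SymM.
      (1/2) *\<^sub>R (transpose X ** X ** S + S ** transpose X ** X)
        = (1/2) *\<^sub>R H X (transpose X ** X - mat 1) \<longrightarrow>
      landing_dN (landing_metric G_T G_N X) H X =
        - (X ** gram_inv X ** msym (transpose X ** X ** S)))
    \<and> ((\<forall>S\<in>SymM. H X S = S) \<longrightarrow>
      landing_dN (landing_metric G_T G_N X) H X = - (1/2) *\<^sub>R (X ** (mat 1 - gram_inv X)))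
    \<and> ((\<forall>S\<in>SymM. H X S = Dc X (Dc_adj (landing_metric G_T G_N X) X S)) \<longrightarrow>
      landing_dN (landing_metric G_T G_N X) H X =
        - (1/2) *\<^sub>R tildeN_inv G_N X (X ** (transpose X ** X - mat 1)))
    \<and> ((\<forall>S\<in>SymM. H X S = Dc X (Dc_adj (\<bullet>) X S)) \<longrightarrow>
      landing_dN (landing_metric G_T G_N X) H X = - (1/2) *\<^sub>R (X ** (transpose X ** X - mat 1)))"
proof -
  interpret landing X G_T G_N
    using assms by (simp add: landing_def full_column_rank_def landing_axioms_def)
  let ?M = "transpose X ** X - mat 1"
  note H = \<open>symmetric_operator_on SymM (H X)\<close>
  have f: "f differentiable at X"
    using assms(3) by (auto simp: continuously_differentiable_def differentiable_def)
  \<comment> \<open>\<open>H X\<close> is linear only on \<open>SymM\<close>, so pulling out the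
    factor 1/2 of \<open>constr X\<close> uses the symmetry of \<open>?M\<close>.\<close>
  have HM: "H X ?M \<in> SymM" "H X (constr X) = (1/2) *\<^sub>R H X ?M"
    using H SymM_gram_minus_one[of X] unfolding symmetric_operator_on_def constr_def by blast+
  have T: "(1/2) *\<^sub>R H X ?M \<in> SymM"
    using HM(1) by (simp add: SymM_def transpose_scalar)
  have dT: "landing_dT g f X = - tildeT_inv G_T X
      (X ** mskew (gram_inv X ** transpose X ** gradE f X)
        + (mat 1 - X ** gram_inv X ** transpose X) ** gradE f X)"
    by (simp add: landing_dT_def gradSt_eq[OF f] adjoint_ProjT)
  have dN: "landing_dN g H X = - (X ** gram_inv X ** msym (transpose X ** X ** S))"
    if "S \<in> SymM"
      and "(1/2) *\<^sub>R (transpose X ** X ** S + S ** transpose X ** X) = (1/2) *\<^sub>R H X ?M" for S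
  proof -
    \<comment> \<open>For symmetric \<open>S\<close> the transpose of
      \<open>transpose X ** X ** S\<close> is \<open>S ** transpose X ** X\<close>, so the Sylvester
      equation prescribes exactly this symmetric part.\<close>
    have "msym (transpose X ** X ** S) = (1/2) *\<^sub>R H X ?M"
      using that by (simp add: msym_def SymM_def matrix_transpose_mul matrix_mul_assoc)
    then show ?thesis
      by (simp add: landing_dN_eq[where H = H, OF H] HM(2))
  qed
  have i: "landing_dN g H X = - (1/2) *\<^sub>R (X ** (mat 1 - gram_inv X))" if "\<forall>S\<in>SymM. H X S = S"
  proof -
    have "X ** gram_inv X ** ?M = X ** (mat 1 - gram_inv X)"
      by (simp add: matrix_linear_simps matrix_mul_assoc[symmetric] gram_inverse)
    moreover have "H X ?M = ?M"
      using that SymM_gram_minus_one by blast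
    ultimately show ?thesis
      by (simp add: landing_dN_eq[where H = H, OF H] HM(2) matrix_mult_scaleR)
  qed
  have ii: "landing_dN g H X = - (1/2) *\<^sub>R tildeN_inv G_N X (X ** ?M)"
    if "\<forall>S\<in>SymM. H X S = Dc X (Dc_adj g X S)"
  proof -
    have "landing_dN g H X = - Dc_adj g X (constr X)"
      using that constr_SymM Dc_adj_normal by (intro landing_dN_Dc_adj) auto
    also have "Dc_adj g X (constr X) = tildeN_inv G_N X ((1/2) *\<^sub>R (X ** ?M))"
      by (simp only: Dc_adj_eq msym_id[OF constr_SymM]) (simp add: constr_def matrix_mult_scaleR)
    finally show ?thesis
      by (simp add: tildeN_inv_scaleR[OF SymM_gram_minus_one])
  qed
  have iii: "landing_dN g H X = - (1/2) *\<^sub>R (X ** ?M)"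
    if "\<forall>S\<in>SymM. H X S = Dc X (Dc_adj (\<bullet>) X S)"
  proof -
    \<comment> \<open>\<open>constr X\<close> is a polynomial in \<open>transpose X ** X\<close>,
      hence commutes with it and the product is symmetric. This is the symmetric factor that shows
      \<open>X ** constr X\<close> to be normal.\<close>
    have "transpose X ** X ** constr X \<in> SymM"
      by (simp add: SymM_def constr_def matrix_linear_simps matrix_transpose_mul matrix_mul_assoc)
    moreover have "X ** constr X = X ** gram_inv X ** (transpose X ** X ** constr X)"
      by (metis gram_inverse(2) matrix_mul_assoc matrix_mul_rid)
    ultimately have "X ** constr X \<in> normalSt X"
      by (auto simp: normalSt_def)
    moreover have "H X (constr X) = Dc X (X ** constr X)"
      using that by (simp add: constr_SymM Dc_adj_frobenius)
    ultimately have "landing_dN g H X = - (X ** constr X)"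
      by (intro landing_dN_Dc_adj)
    then show ?thesis
      by (simp add: constr_def matrix_mult_scaleR)
  qed
  show ?thesis
    using dT sylvester_ex1[OF T] dN i ii iii by blast
qed

end
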